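(* For $m\ge2$, the NCCC-graph $\Gamma_{V_{8m}}$ is not hyperenergetic, and it is L-hyperenergetic and Q-hyperenergetic if and only if $m\ne 2$ (i.e. $m\ge3$).
   Context: $V_{8m}=\langle x,y\mid x^{2m}=y^4=1,\ yx=x^{-1}y^{-1},\ y^{-1}x=x^{-1}y\rangle$. The NCCC-graph $\Gamma_G$ of a finite non-abelian group $G$ with center $Z(G)$ has vertex set $\{x^G: x\in G\setminus Z(G)\}$ ($x^G$ the conjugacy class of $x$), distinct vertices $x^G,y^G$ adjacent iff $x'y'\neq y'x'$ for all $x'\in x^G,y'\in y^G$. For a simple graph $\mathcal G$ with adjacency matrix $A$, degree matrix $D$, $L=D-A$, $Q=D+A$: $E(\mathcal G)=\sum|\lambda|$ over eigenvalues of $A$; with $\Delta=2|E(\mathcal G)|/|V(\mathcal G)|$, $LE(\mathcal G)=\sum|\beta-\Delta|$ over eigenvalues of $L$, $SE(\mathcal G)=\sum|\gamma-\Delta|$ over eigenvalues of $Q$. For $N=|V(\mathcal G)|$, $E(K_N)=LE(K_N)=SE(K_N)=2(N-1)$. $\mathcal G$ is hyperenergetic (resp. L-, Q-hyperenergetic) if $E(\mathcal G)>E(K_N)$ (resp. $LE(\mathcal G)>LE(K_N)$, $SE(\mathcal G)>SE(K_N)$). *)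

theory Defs
  imports "HOL-Algebra.Group" "HOL-Algebra.Generated_Groups"
    "Jordan_Normal_Form.Matrix" "Jordan_Normal_Form.Char_Poly"
begin

definition grp_center :: "('a, 'b) monoid_scheme \<Rightarrow> 'a set" where
  "grp_center G = {z \<in> carrier G. \<forall>g \<in> carrier G. z \<otimes>\<^bsub>G\<^esub> g = g \<otimes>\<^bsub>G\<^esub> z}"

definition conj_class :: "('a, 'b) monoid_scheme \<Rightarrow> 'a \<Rightarrow> 'a set" where
  "conj_class G x = {g \<otimes>\<^bsub>G\<^esub> x \<otimes>\<^bsub>G\<^esub> inv\<^bsub>G\<^esub> g | g. g \<in> carrier G}"

definition nccc_vertices :: "('a, 'b) monoid_scheme \<Rightarrow> 'a set set" where
  "nccc_vertices G = conj_class G ` (carrier G - grp_center G)"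

definition nccc_adj :: "('a, 'b) monoid_scheme \<Rightarrow> 'a set \<Rightarrow> 'a set \<Rightarrow> bool" where
  "nccc_adj G C D \<longleftrightarrow> C \<noteq> D \<and>
     (\<forall>a \<in> C. \<forall>b \<in> D. a \<otimes>\<^bsub>G\<^esub> b \<noteq> b \<otimes>\<^bsub>G\<^esub> a)"

text \<open>An (arbitrary) enumeration of the vertices; all spectral notions below are
  independent of this choice.\<close>
definition vert_enum :: "'v set \<Rightarrow> nat \<Rightarrow> 'v" where
  "vert_enum V = (SOME f. bij_betw f {..<card V} V)"

definition adj_matrix :: "'v set \<Rightarrow> ('v \<Rightarrow> 'v \<Rightarrow> bool) \<Rightarrow> real mat" where
  "adj_matrix V adj = mat (card V) (card V)
     (\<lambda>(i, j). if adj (vert_enum V i) (vert_enum V j) then 1 else 0)"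

definition vdeg :: "'v set \<Rightarrow> ('v \<Rightarrow> 'v \<Rightarrow> bool) \<Rightarrow> 'v \<Rightarrow> nat" where
  "vdeg V adj v = card {w \<in> V. adj v w}"

definition deg_matrix :: "'v set \<Rightarrow> ('v \<Rightarrow> 'v \<Rightarrow> bool) \<Rightarrow> real mat" where
  "deg_matrix V adj = mat (card V) (card V)
     (\<lambda>(i, j). if i = j then real (vdeg V adj (vert_enum V i)) else 0)"

definition laplacian_matrix :: "'v set \<Rightarrow> ('v \<Rightarrow> 'v \<Rightarrow> bool) \<Rightarrow> real mat" where
  "laplacian_matrix V adj = deg_matrix V adj - adj_matrix V adj"

definition signless_laplacian_matrix :: "'v set \<Rightarrow> ('v \<Rightarrow> 'v \<Rightarrow> bool) \<Rightarrow> real mat" where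
  "signless_laplacian_matrix V adj = deg_matrix V adj + adj_matrix V adj"

definition eigenvalues_mset :: "real mat \<Rightarrow> complex multiset" where
  "eigenvalues_mset A = proots (char_poly (map_mat complex_of_real A))"

definition num_edges :: "'v set \<Rightarrow> ('v \<Rightarrow> 'v \<Rightarrow> bool) \<Rightarrow> nat" where
  "num_edges V adj = card {{v, w} | v w. v \<in> V \<and> w \<in> V \<and> adj v w}"

definition avg_degree :: "'v set \<Rightarrow> ('v \<Rightarrow> 'v \<Rightarrow> bool) \<Rightarrow> real" where
  "avg_degree V adj = 2 * real (num_edges V adj) / real (card V)"

definition energy :: "'v set \<Rightarrow> ('v \<Rightarrow> 'v \<Rightarrow> bool) \<Rightarrow> real" where
  "energy V adj = (\<Sum>\<mu>\<in>#eigenvalues_mset (adj_matrix V adj). cmod \<mu>)"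

definition L_energy :: "'v set \<Rightarrow> ('v \<Rightarrow> 'v \<Rightarrow> bool) \<Rightarrow> real" where
  "L_energy V adj = (\<Sum>\<beta>\<in>#eigenvalues_mset (laplacian_matrix V adj).
      cmod (\<beta> - complex_of_real (avg_degree V adj)))"

definition Q_energy :: "'v set \<Rightarrow> ('v \<Rightarrow> 'v \<Rightarrow> bool) \<Rightarrow> real" where
  "Q_energy V adj = (\<Sum>\<gamma>\<in>#eigenvalues_mset (signless_laplacian_matrix V adj).
      cmod (\<gamma> - complex_of_real (avg_degree V adj)))"

text \<open>E(K_N) = LE(K_N) = SE(K_N) = 2(N-1).\<close>
definition complete_graph_energy :: "nat \<Rightarrow> real" where
  "complete_graph_energy N = 2 * (real N - 1)"

definition hyperenergetic :: "'v set \<Rightarrow> ('v \<Rightarrow> 'v \<Rightarrow> bool) \<Rightarrow> bool" where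
  "hyperenergetic V adj \<longleftrightarrow> energy V adj > complete_graph_energy (card V)"

definition L_hyperenergetic :: "'v set \<Rightarrow> ('v \<Rightarrow> 'v \<Rightarrow> bool) \<Rightarrow> bool" where
  "L_hyperenergetic V adj \<longleftrightarrow> L_energy V adj > complete_graph_energy (card V)"

definition Q_hyperenergetic :: "'v set \<Rightarrow> ('v \<Rightarrow> 'v \<Rightarrow> bool) \<Rightarrow> bool" where
  "Q_hyperenergetic V adj \<longleftrightarrow> Q_energy V adj > complete_graph_energy (card V)"

text \<open>G is (isomorphic to) V_{8m} = <x,y | x^{2m} = y^4 = 1, yx = x^{-1}y^{-1}, y^{-1}x = x^{-1}y>:
  G is generated by x, y satisfying the defining relations, and |G| = 8m = |V_{8m}|.
  Since the presented group has order 8m, such a G is isomorphic to it.\<close>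
definition is_V8m :: "('a, 'b) monoid_scheme \<Rightarrow> nat \<Rightarrow> 'a \<Rightarrow> 'a \<Rightarrow> bool" where
  "is_V8m G m x y \<longleftrightarrow> group G \<and> x \<in> carrier G \<and> y \<in> carrier G \<and>
     generate G {x, y} = carrier G \<and>
     x [^]\<^bsub>G\<^esub> (2 * m) = \<one>\<^bsub>G\<^esub> \<and> y [^]\<^bsub>G\<^esub> (4::nat) = \<one>\<^bsub>G\<^esub> \<and>
     y \<otimes>\<^bsub>G\<^esub> x = inv\<^bsub>G\<^esub> x \<otimes>\<^bsub>G\<^esub> inv\<^bsub>G\<^esub> y \<and>
     inv\<^bsub>G\<^esub> y \<otimes>\<^bsub>G\<^esub> x = inv\<^bsub>G\<^esub> x \<otimes>\<^bsub>G\<^esub> y \<and>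
     finite (carrier G) \<and> card (carrier G) = 8 * m"

end

theory Submission
  imports Defs
begin

text \<open>In $V_{8m}$ the elements are the products $x^i y^j$, and the conjugacy classes of
  noncentral elements fall into three parts: $j$ odd and $i$ even, $j$ odd and $i$ odd, $j$ even.
  Classes in one part contain commuting representatives, and elements of different
  parts never commute, so the NCCC-graph is complete tripartite: $K_{1,1,2m-1}$ for odd $m$ and
  $K_{2,2,2m-2}$ for even $m$. The matrices involved are constant on blocks apart from the diagonal,
  so the determinant identity $\det(1 + UV) = \det(1 + VU)$ reduces their characteristic polynomials to
  those of $3 \times 3$ quotient matrices. The energies then become explicit, and the remaining
  inequalities are elementary; for $m = 2$ the graph is the octahedron, with $LE = SE = 8 < 10$.\<close>

section \<open>Characteristic polynomials of block-constant matrices\<close>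

text \<open>Both \<open>X * Y\<close> and \<open>Y * X\<close> are block lower triangular, with an
  identity as one diagonal block and \<open>1 + V * U\<close> or \<open>1 + U * V\<close> as the
  other. Multiplicativity of \<open>det\<close> equates the two products without any
  division.\<close>

lemma det_one_plus_mult_commute:
  fixes U V :: "'a :: idom mat"
  assumes U: "U \<in> carrier_mat n k" and V: "V \<in> carrier_mat k n"
  shows "det (1\<^sub>m n + U * V) = det (1\<^sub>m k + V * U)"
proof -
  define X where "X = four_block_mat (1\<^sub>m n) (- U) V (1\<^sub>m k)"
  define Y where "Y = four_block_mat (1\<^sub>m n) U (0\<^sub>m k n) (1\<^sub>m k)"
  have X: "X \<in> carrier_mat (n + k) (n + k)" and Y: "Y \<in> carrier_mat (n + k) (n + k)"
    using U V by (auto simp: X_def Y_def)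
  have UV: "U * V \<in> carrier_mat n n" and VU: "V * U \<in> carrier_mat k k"
    using U V by auto
  have XY: "X * Y = four_block_mat (1\<^sub>m n) (0\<^sub>m n k) V (1\<^sub>m k + V * U)"
    unfolding X_def Y_def
    by (subst mult_four_block_mat[of _ n n _ k _ k _ _ n _ k])
       (use U V UV VU in \<open>auto simp: comm_add_mat[OF VU]\<close>)
  have YX: "Y * X = four_block_mat (1\<^sub>m n + U * V) (0\<^sub>m n k) V (1\<^sub>m k)"
    unfolding X_def Y_def
    by (subst mult_four_block_mat[of _ n n _ k _ k _ _ n _ k])
       (use U V UV VU in \<open>auto\<close>)
  have "det (1\<^sub>m n + U * V) = det (Y * X)"
    unfolding YX by (subst det_four_block_mat_upper_right_zero[of _ n _ k]) (use U V UV in auto)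
  also have "\<dots> = det (X * Y)"
    using det_mult[OF X Y] det_mult[OF Y X] by simp
  also have "\<dots> = det (1\<^sub>m k + V * U)"
    unfolding XY by (subst det_four_block_mat_upper_right_zero[of _ n _ k]) (use U V VU in auto)
  finally show ?thesis .
qed

text \<open>Allows characteristic polynomials to be compared through scalar determinants only at
  points where the required inverses exist.\<close>

lemma poly_eqI_cofinite:
  fixes P Q :: "'a :: {idom, ring_char_0} poly"
  assumes "finite S" "\<And>t. t \<notin> S \<Longrightarrow> poly P t = poly Q t"
  shows "P = Q"
proof (rule ccontr)
  assume "P \<noteq> Q"
  hence "finite {t. poly (P - Q) t = 0}" by (intro poly_roots_finite) auto
  moreover have "- S \<subseteq> {t. poly (P - Q) t = 0}" using assms(2) by auto
  ultimately have "finite (- S)" by (rule rev_finite_subset)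
  hence "finite (UNIV :: 'a set)" using assms(1) by (metis finite_compl)
  thus False using infinite_UNIV_char_0 by blast
qed

lemma poly_char_poly_eq_det:
  fixes A :: "'a :: field mat"
  assumes "A \<in> carrier_mat n n"
  shows "poly (char_poly A) t = det (t \<cdot>\<^sub>m 1\<^sub>m n - A)"
  unfolding char_poly_matrix[OF assms]
  by (rule arg_cong[of _ _ det], rule eq_matI) (use assms in \<open>auto simp: char_matrix_def\<close>)

lemma det_diag:
  fixes f :: "nat \<Rightarrow> 'a :: idom"
  shows "det (mat n n (\<lambda>(i, j). if i = j then f i else 0)) = (\<Prod>i<n. f i)"
  by (subst det_upper_triangular[of _ n])
     (auto simp: upper_triangular_def diag_mat_def atLeast0LessThan
        simp flip: prod.distinct_set_conv_list intro!: prod.cong)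

lemma diag_mult_index:
  fixes W :: "'a :: comm_ring_1 mat"
  assumes "W \<in> carrier_mat n m" "i < n" "j < m"
  shows "(mat n n (\<lambda>(i, j). if i = j then f i else 0) * W) $$ (i, j) = f i * W $$ (i, j)"
proof -
  have "(mat n n (\<lambda>(i, j). if i = j then f i else 0) * W) $$ (i, j)
      = (\<Sum>l\<in>{0..<n}. (if i = l then f i else 0) * W $$ (l, j))"
    using assms by (auto simp: scalar_prod_def intro!: sum.cong)
  also have "\<dots> = (\<Sum>l\<in>{0..<n}. if i = l then f i * W $$ (l, j) else 0)"
    by (intro sum.cong) auto
  finally show ?thesis using assms by simp
qed

lemma mult_diag_index:
  fixes W :: "'a :: comm_ring_1 mat"
  assumes "W \<in> carrier_mat m n" "i < m" "j < n"
  shows "(W * mat n n (\<lambda>(i, j). if i = j then f i else 0)) $$ (i, j) = W $$ (i, j) * f j"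
proof -
  have "(W * mat n n (\<lambda>(i, j). if i = j then f i else 0)) $$ (i, j)
      = (\<Sum>l\<in>{0..<n}. W $$ (i, l) * (if l = j then f j else 0))"
    using assms by (auto simp: scalar_prod_def intro!: sum.cong)
  also have "\<dots> = (\<Sum>l\<in>{0..<n}. if l = j then W $$ (i, l) * f j else 0)"
    by (intro sum.cong) auto
  finally show ?thesis using assms by simp
qed

text \<open>\<open>?N\<close> is the quotient matrix of the equitable partition \<open>p\<close>:
  the constant blocks are weighted by class sizes. Away from the values \<open>d c\<close>, dividing
  by the diagonal part leaves the identity plus a matrix that factors through dimension
  \<open>k\<close>. With class sizes written \<open>Suc (r c)\<close>, the leftover multiplicity of
  the root \<open>d c\<close> is \<open>r c\<close>, with no natural subtraction.\<close>

lemma char_poly_equitable_partition: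
  fixes d :: "nat \<Rightarrow> 'a :: {field, ring_char_0}" and b :: "nat \<Rightarrow> nat \<Rightarrow> 'a"
  assumes p: "\<And>i. i < n \<Longrightarrow> p i < k"
    and cnt: "\<And>c. c < k \<Longrightarrow> card {i. i < n \<and> p i = c} = Suc (r c)"
  shows "char_poly (mat n n (\<lambda>(i, j). (if i = j then d (p i) else 0) + b (p i) (p j)))
    = (\<Prod>c<k. [:- d c, 1:] ^ r c)
      * char_poly (mat k k (\<lambda>(c, e). (if c = e then d c else 0) + b c e * of_nat (Suc (r e))))"
    (is "char_poly ?M = _ * char_poly ?N")
proof (rule poly_eqI_cofinite)
  show "finite (d ` {..<k})" by simp
  fix t assume t: "t \<notin> d ` {..<k}"
  hence nz: "t - d c \<noteq> 0" if "c < k" for c using that by auto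
  \<comment> \<open>Chosen so that \<open>1 + U * V\<close> is \<open>t - ?M\<close> with rows
    divided by the diagonal of \<open>T\<close>, while \<open>1 + V * U\<close> is
    \<open>t - ?N\<close> with columns divided by the diagonal of \<open>S\<close>.\<close>
  define U where "U = mat n k (\<lambda>(i, c). if p i = c then 1 / (t - d c) else 0)"
  define V where "V = mat k n (\<lambda>(c, j). - b c (p j))"
  define T where "T = mat n n (\<lambda>(i, j). if i = j then t - d (p i) else 0)"
  define S where "S = mat k k (\<lambda>(i, j). if i = j then t - d i else 0)"
  have UVe: "(U * V) $$ (i, j) = - b (p i) (p j) / (t - d (p i))" if "i < n" "j < n" for i j
  proof -
    have "(U * V) $$ (i, j) = (\<Sum>c\<in>{0..<k}. (if p i = c then 1 / (t - d c) else 0) * - b c (p j))"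
      using that by (simp add: U_def V_def scalar_prod_def)
    also have "\<dots> = (\<Sum>c\<in>{0..<k}. if p i = c then - b c (p j) / (t - d c) else 0)"
      by (intro sum.cong) auto
    finally show ?thesis using p[OF that(1)] by simp
  qed
  have VUe: "(V * U) $$ (c, e) = - of_nat (Suc (r e)) * b c e / (t - d e)" if "c < k" "e < k" for c e
  proof -
    have "(V * U) $$ (c, e) = (\<Sum>i\<in>{0..<n}. - b c (p i) * (if p i = e then 1 / (t - d e) else 0))"
      using that by (simp add: U_def V_def scalar_prod_def)
    also have "\<dots> = (\<Sum>i\<in>{i. i < n \<and> p i = e}. - b c e / (t - d e))"
      by (rule sum.mono_neutral_cong_right) auto
    finally show ?thesis using cnt[OF that(2)] by (simp add: field_simps del: of_nat_Suc)
  qed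
  have carr: "U \<in> carrier_mat n k" "V \<in> carrier_mat k n" "T \<in> carrier_mat n n" "S \<in> carrier_mat k k"
    by (auto simp: U_def V_def T_def S_def)
  have TM: "t \<cdot>\<^sub>m 1\<^sub>m n - ?M = T * (1\<^sub>m n + U * V)"
  proof (rule eq_matI)
    fix i j assume "i < dim_row (T * (1\<^sub>m n + U * V))" "j < dim_col (T * (1\<^sub>m n + U * V))"
    hence ij: "i < n" "j < n" using carr by auto
    have "(T * (1\<^sub>m n + U * V)) $$ (i, j) = (t - d (p i)) * (1\<^sub>m n + U * V) $$ (i, j)"
      unfolding T_def by (rule diag_mult_index) (use carr ij in auto)
    also have "(1\<^sub>m n + U * V) $$ (i, j) = (if i = j then 1 else 0) + (U * V) $$ (i, j)"
      using ij carr by (simp del: index_mult_mat(1))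
    finally show "(t \<cdot>\<^sub>m 1\<^sub>m n - ?M) $$ (i, j) = (T * (1\<^sub>m n + U * V)) $$ (i, j)"
      using ij nz[OF p[OF ij(1)]] by (simp add: UVe right_diff_distrib del: index_mult_mat(1))
  qed (use carr in auto)
  have SN: "t \<cdot>\<^sub>m 1\<^sub>m k - ?N = (1\<^sub>m k + V * U) * S"
  proof (rule eq_matI)
    fix i j assume "i < dim_row ((1\<^sub>m k + V * U) * S)" "j < dim_col ((1\<^sub>m k + V * U) * S)"
    hence ij: "i < k" "j < k" using carr by auto
    have "((1\<^sub>m k + V * U) * S) $$ (i, j) = (1\<^sub>m k + V * U) $$ (i, j) * (t - d j)"
      unfolding S_def by (rule mult_diag_index) (use carr ij in auto)
    also have "(1\<^sub>m k + V * U) $$ (i, j) = (if i = j then 1 else 0) + (V * U) $$ (i, j)"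
      using ij carr by (simp del: index_mult_mat(1))
    finally show "(t \<cdot>\<^sub>m 1\<^sub>m k - ?N) $$ (i, j) = ((1\<^sub>m k + V * U) * S) $$ (i, j)"
      using ij nz[OF ij(2)] by (simp add: VUe left_diff_distrib del: index_mult_mat(1) of_nat_Suc)
  qed (use carr in auto)
  \<comment> \<open>Grouping by classes: \<open>S\<close> takes one factor from each class, and the
    remaining \<open>r c\<close> factors become the explicit powers.\<close>
  have "(\<Prod>i<n. t - d (p i)) = (\<Prod>c<k. \<Prod>i\<in>{i\<in>{..<n}. p i = c}. t - d (p i))"
    using p by (intro prod.group[symmetric]) auto
  also have "\<dots> = (\<Prod>c<k. (t - d c) ^ Suc (r c))"
  proof (rule prod.cong)
    fix c assume c: "c \<in> {..<k}"
    have "(\<Prod>i\<in>{i\<in>{..<n}. p i = c}. t - d (p i)) = (\<Prod>i\<in>{i\<in>{..<n}. p i = c}. t - d c)"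
      by (rule prod.cong) auto
    thus "(\<Prod>i\<in>{i\<in>{..<n}. p i = c}. t - d (p i)) = (t - d c) ^ Suc (r c)"
      using cnt[of c] c by simp
  qed simp
  finally have prodT: "det T = (\<Prod>c<k. (t - d c) ^ r c) * det S"
    unfolding T_def S_def by (simp add: det_diag prod.distrib)
  have "poly (char_poly ?M) t = det T * det (1\<^sub>m n + U * V)"
    by (subst poly_char_poly_eq_det[of _ n], simp, unfold TM, rule det_mult) (use carr in auto)
  also have "\<dots> = (\<Prod>c<k. (t - d c) ^ r c) * (det (1\<^sub>m k + V * U) * det S)"
    by (simp add: prodT det_one_plus_mult_commute[OF carr(1,2)])
  also have "det (1\<^sub>m k + V * U) * det S = poly (char_poly ?N) t"
    by (subst poly_char_poly_eq_det[of _ k], simp, unfold SN, rule det_mult[symmetric]) (use carr in auto)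
  finally show "poly (char_poly ?M) t = poly ((\<Prod>c<k. [:- d c, 1:] ^ r c) * char_poly ?N) t"
    by (simp add: poly_prod)
qed

lemma det_3:
  fixes A :: "'a :: comm_ring_1 mat"
  assumes A: "A \<in> carrier_mat 3 3"
  shows "det A = A $$ (0,0) * (A $$ (1,1) * A $$ (2,2) - A $$ (1,2) * A $$ (2,1))
     - A $$ (0,1) * (A $$ (1,0) * A $$ (2,2) - A $$ (1,2) * A $$ (2,0))
     + A $$ (0,2) * (A $$ (1,0) * A $$ (2,1) - A $$ (1,1) * A $$ (2,0))"
proof -
  have det_2: "det B = B $$ (0,0) * B $$ (1,1) - B $$ (0,1) * B $$ (1,0)"
    if B: "B \<in> carrier_mat 2 2" for B :: "'a mat"
    by (subst laplace_expansion_row[OF B, of 0])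
       (use B in \<open>auto simp: cofactor_def mat_delete_def numeral_2_eq_2 det_single\<close>)
  show ?thesis
    by (subst laplace_expansion_row[OF A, of 0])
       (use A in \<open>auto simp: cofactor_def mat_delete_def numeral_3_eq_3 numeral_2_eq_2 
          det_2[unfolded numeral_2_eq_2] algebra_simps\<close>)
qed

text \<open>The spectrum is defined by complex roots; a splitting over the reals carries over along
  \<open>complex_of_real\<close> and displays the roots with multiplicity.\<close>

lemma eigenvalues_mset_eq:
  assumes A: "A \<in> carrier_mat n n" and cp: "char_poly A = (\<Prod>e\<leftarrow>es. [:- e, 1:])"
  shows "eigenvalues_mset A = image_mset complex_of_real (mset es)"
proof -
  interpret h: map_poly_comm_ring_hom complex_of_real ..
  have hom: "map_poly complex_of_real (\<Prod>e\<leftarrow>es. [:- e, 1:]) = (\<Prod>e\<leftarrow>es. [:- complex_of_real e, 1:])" for es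
    by (induction es) (simp_all add: h.hom_mult of_real_hom.map_poly_pCons_hom del: mult_pCons_left)
  have "proots (\<Prod>e\<leftarrow>es. [:- complex_of_real e, 1:]) = image_mset complex_of_real (mset es)"
  proof (induction es)
    case (Cons e es)
    have "(\<Prod>e\<leftarrow>es. [:- complex_of_real e, 1:]) \<noteq> 0" by (auto simp: prod_list_zero_iff)
    thus ?case using Cons by (simp add: proots_mult del: mult_pCons_left)
  qed auto
  thus ?thesis
    unfolding eigenvalues_mset_def of_real_hom.char_poly_hom[OF A] cp hom .
qed

section \<open>Spectra of complete tripartite graphs\<close>

lemma vert_enum_bij:
  assumes "finite V"
  shows "bij_betw (vert_enum V) {..<card V} V"
proof -
  obtain h where "bij_betw h {0..<card V} V"
    using ex_bij_betw_nat_finite[OF assms] by blast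
  thus ?thesis unfolding vert_enum_def by (metis (lifting) atLeast0LessThan someI_ex)
qed

text \<open>Disjointness makes an unordered pair determine the ordered one. This counts the edges
  between two parts.\<close>

lemma card_doubleton_image:
  assumes "A \<inter> B = {}"
  shows "card ((\<lambda>(v, w). {v, w}) ` (A \<times> B)) = card A * card B"
  by (subst card_image) (use assms in \<open>auto simp: inj_on_def doubleton_eq_iff card_cartesian_product\<close>)

text \<open>The graph K_{a,a,b}, encoded by a labelling of its vertices. Successors as sizes keep
  every part nonempty and match the form used in
  \<open>char_poly_equitable_partition\<close>.\<close>

locale complete_tripartite =
  fixes V :: "'v set" and adj :: "'v \<Rightarrow> 'v \<Rightarrow> bool" and p :: "'v \<Rightarrow> nat" and r s :: nat
  assumes finite: "finite V"
    and part_less: "v \<in> V \<Longrightarrow> p v < 3"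
    and adj_iff: "v \<in> V \<Longrightarrow> w \<in> V \<Longrightarrow> adj v w \<longleftrightarrow> p v \<noteq> p w"
    and card_part: "card {v \<in> V. p v = 0} = Suc r" "card {v \<in> V. p v = 1} = Suc r"
      "card {v \<in> V. p v = 2} = Suc s"
begin

abbreviation a :: real where "a \<equiv> real (Suc r)"
abbreviation b :: real where "b \<equiv> real (Suc s)"

definition psize :: "nat \<Rightarrow> nat" where "psize c = (if c < 2 then r else s)"

lemma card_part': "c < 3 \<Longrightarrow> card {v \<in> V. p v = c} = Suc (psize c)"
  using card_part by (auto simp: psize_def less_Suc_eq numeral_3_eq_3 numeral_2_eq_2)

lemma card_V_part: 
  assumes "c < 3" shows "card V = card {v \<in> V. p v \<noteq> c} + Suc (psize c)"
proof -
  have "card V = card ({v \<in> V. p v \<noteq> c} \<union> {v \<in> V. p v = c})"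
    by (rule arg_cong[of _ _ card]) auto
  also have "\<dots> = card {v \<in> V. p v \<noteq> c} + card {v \<in> V. p v = c}"
    using finite by (intro card_Un_disjoint) auto
  finally show ?thesis using card_part'[OF assms] by simp
qed

lemma card_V: "card V = 2 * Suc r + Suc s"
proof -
  have "{v \<in> V. p v \<noteq> 2} = {v \<in> V. p v = 0} \<union> {v \<in> V. p v = 1}"
    using part_less by (force simp: numeral_3_eq_3 less_Suc_eq)
  moreover have "card \<dots> = card {v \<in> V. p v = 0} + card {v \<in> V. p v = 1}"
    using finite by (intro card_Un_disjoint) auto
  ultimately show ?thesis using card_V_part[of 2] card_part by (simp add: psize_def)
qed

lemma vdeg_eq:
  assumes "v \<in> V" shows "real (vdeg V adj v) = (if p v < 2 then a + b else 2 * a)"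
proof -
  have "{w \<in> V. adj v w} = {w \<in> V. p w \<noteq> p v}" using assms adj_iff by auto
  thus ?thesis using card_V_part[OF part_less[OF assms]] card_V
    by (auto simp: vdeg_def psize_def split: if_splits)
qed

lemma num_edges_eq: "real (num_edges V adj) = a\<^sup>2 + 2 * a * b"
proof -
  define P where "P c = {v \<in> V. p v = c}" for c
  define E where "E c d = (\<lambda>(v, w). {v, w}) ` (P c \<times> P d)" for c d
  have cardE: "card (E c d) = card (P c) * card (P d)" if "c \<noteq> d" for c d
    unfolding E_def by (rule card_doubleton_image) (use that in \<open>auto simp: P_def\<close>)
  have finE: "finite (E c d)" for c d using finite by (simp add: E_def P_def)
  \<comment> \<open>The labels of the two ends identify the family containing an edge, so the three
    families are pairwise disjoint.\<close>
  have Esub: "p ` e = {c, d}" if "e \<in> E c d" for e c d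
    using that by (auto simp: E_def P_def)
  have disj: "E c d \<inter> E c' d' = {}" if "{c, d} \<noteq> {c', d'}" for c d c' d'
    using that Esub[of _ c d] Esub[of _ c' d'] by (metis disjoint_iff)
  have "{{v, w} |v w. v \<in> V \<and> w \<in> V \<and> adj v w} = E 0 1 \<union> (E 0 2 \<union> E 1 2)"
  proof (intro equalityI subsetI)
    fix e assume "e \<in> {{v, w} |v w. v \<in> V \<and> w \<in> V \<and> adj v w}"
    then obtain v w where e: "e = {v, w}" "v \<in> V" "w \<in> V" "p v \<noteq> p w"
      using adj_iff by auto
    have *: "e \<in> E c d" if "p v = c \<and> p w = d \<or> p v = d \<and> p w = c" for c d
      using that e by (auto simp: E_def P_def image_iff doubleton_eq_iff)
    show "e \<in> E 0 1 \<union> (E 0 2 \<union> E 1 2)"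
      using e(4) part_less[OF e(2)] part_less[OF e(3)] *[of 0 1] *[of 0 2] *[of 1 2]
      by (auto simp: numeral_3_eq_3 numeral_2_eq_2 less_Suc_eq)
  next
    fix e assume "e \<in> E 0 1 \<union> (E 0 2 \<union> E 1 2)"
    then obtain v w where "e = {v, w}" "v \<in> V" "w \<in> V" "p v \<noteq> p w"
      by (auto simp: E_def P_def)
    thus "e \<in> {{v, w} |v w. v \<in> V \<and> w \<in> V \<and> adj v w}" using adj_iff by blast
  qed
  also have "card (E 0 1 \<union> (E 0 2 \<union> E 1 2)) = card (E 0 1) + (card (E 0 2) + card (E 1 2))"
    using finE disj by (subst card_Un_disjoint, auto simp: Int_Un_distrib doubleton_eq_iff)+
  finally show ?thesis
    unfolding num_edges_def by (simp add: cardE P_def card_part card_part(2)[unfolded One_nat_def] power2_eq_square algebra_simps)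
qed

lemma avg_degree_eq: "avg_degree V adj = 2 * (a\<^sup>2 + 2 * a * b) / (2 * a + b)"
  unfolding avg_degree_def num_edges_eq card_V by simp

text \<open>Treats all three matrices at once: (\<open>\<sigma>\<close>, \<open>\<rho>\<close>) is
  (0, 1) for adjacency, (1, -1) for the Laplacian and (1, 1) for the signless Laplacian. The numbers
  \<open>e\<close> and \<open>f\<close> are the roots of the quadratic factor of the quotient
  polynomial, prescribed by their sum and product.\<close>

lemma eigenvalues_combination:
  fixes \<sigma> \<rho> e f :: real
  assumes sum: "e + f = \<sigma> * (3 * a + b) + \<rho> * a"
    and prod: "e * f = 2 * \<sigma> * a * (\<sigma> * (a + b) + \<rho> * a) - 2 * \<rho>\<^sup>2 * a * b"
  shows "eigenvalues_mset (\<sigma> \<cdot>\<^sub>m deg_matrix V adj + \<rho> \<cdot>\<^sub>m adj_matrix V adj)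
    = image_mset complex_of_real (mset (replicate (2 * r) (\<sigma> * (a + b)) @ replicate s (2 * \<sigma> * a)
        @ [\<sigma> * (a + b) - \<rho> * a, e, f]))"
proof (rule eigenvalues_mset_eq)
  let ?n = "card V" and ?q = "p \<circ> vert_enum V"
  define d where "d c = (if c < 2 then \<sigma> * (a + b) else 2 * \<sigma> * a)" for c :: nat
  define B where "B c c' = (if c = c' then 0 else \<rho>)" for c c' :: nat
  let ?M = "mat ?n ?n (\<lambda>(i, j). (if i = j then d (?q i) else 0) + B (?q i) (?q j))"
  let ?N = "mat 3 3 (\<lambda>(c, c'). (if c = c' then d c else 0) + B c c' * of_nat (Suc (psize c')))"
  note bij = vert_enum_bij[OF finite]
  have mem: "vert_enum V i \<in> V" if "i < ?n" for i using bij that by (auto simp: bij_betw_def)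
  show "\<sigma> \<cdot>\<^sub>m deg_matrix V adj + \<rho> \<cdot>\<^sub>m adj_matrix V adj \<in> carrier_mat ?n ?n"
    by (auto simp: deg_matrix_def adj_matrix_def)
  have M: "\<sigma> \<cdot>\<^sub>m deg_matrix V adj + \<rho> \<cdot>\<^sub>m adj_matrix V adj = ?M"
    by (rule eq_matI)
      (auto simp: deg_matrix_def adj_matrix_def d_def B_def vdeg_eq[OF mem] adj_iff[OF mem mem])
  have cnt: "card {i. i < ?n \<and> ?q i = c} = Suc (psize c)" if "c < 3" for c
  proof -
    have "bij_betw (vert_enum V) {i. i < ?n \<and> ?q i = c} {v \<in> V. p v = c}"
      using bij unfolding bij_betw_def by (auto simp: inj_on_def image_iff)
    thus ?thesis using card_part'[OF that] by (simp add: bij_betw_same_card)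
  qed
  have "char_poly ?N = (\<Prod>x\<leftarrow>[\<sigma> * (a + b) - \<rho> * a, e, f]. [:- x, 1:])"
  proof (rule poly_eqI_cofinite)
    fix t :: real
    let ?P = "t - \<sigma> * (a + b)" and ?Q = "t - 2 * \<sigma> * a"
    \<comment> \<open>The first two classes are interchangeable: the vector (1, -1, 0) yields the
      linear factor, and vectors with equal first two entries yield the quadratic one.\<close>
    have "poly (char_poly ?N) t = (?P + \<rho> * a) * ((?P - \<rho> * a) * ?Q - 2 * \<rho>\<^sup>2 * a * b)"
      unfolding poly_char_poly_eq_det[of ?N 3, OF mat_carrier]
        det_3[of "t \<cdot>\<^sub>m 1\<^sub>m 3 - ?N", OF minus_carrier_mat[OF mat_carrier]]
      by (simp add: d_def B_def psize_def del: of_nat_Suc)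
        (simp add: algebra_simps power2_eq_square)
    also have "(?P - \<rho> * a) * ?Q - 2 * \<rho>\<^sup>2 * a * b = t\<^sup>2 - (e + f) * t + e * f"
      unfolding sum prod by (simp add: algebra_simps power2_eq_square)
    finally show "poly (char_poly ?N) t = poly (\<Prod>x\<leftarrow>[\<sigma> * (a + b) - \<rho> * a, e, f]. [:- x, 1:]) t"
      by (simp add: algebra_simps power2_eq_square)
  qed (rule finite.emptyI)
  moreover have "char_poly ?M = (\<Prod>c<3. [:- d c, 1:] ^ psize c) * char_poly ?N"
    using part_less[OF mem] cnt by (intro char_poly_equitable_partition) auto
  moreover have "(\<Prod>c<3. [:- d c, 1:] ^ psize c)
      = (\<Prod>x\<leftarrow>replicate (2 * r) (\<sigma> * (a + b)) @ replicate s (2 * \<sigma> * a). [:- x, 1:])"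
    by (simp add: numeral_3_eq_3 d_def psize_def prod_list_replicate flip: power_add mult_2)
  ultimately show "char_poly (\<sigma> \<cdot>\<^sub>m deg_matrix V adj + \<rho> \<cdot>\<^sub>m adj_matrix V adj)
      = (\<Prod>x\<leftarrow>replicate (2 * r) (\<sigma> * (a + b)) @ replicate s (2 * \<sigma> * a)
        @ [\<sigma> * (a + b) - \<rho> * a, e, f]. [:- x, 1:])"
    unfolding M by (simp del: mult_pCons_left mult_pCons_right add: mult_ac)
qed

text \<open>All eigenvalues are real, so moduli become absolute values. The shift is 0 for the
  energy and the average degree for the other two.\<close>

lemma sum_eigenvalues_combination:
  fixes \<sigma> \<rho> e f :: real
  assumes "e + f = \<sigma> * (3 * a + b) + \<rho> * a"
    and "e * f = 2 * \<sigma> * a * (\<sigma> * (a + b) + \<rho> * a) - 2 * \<rho>\<^sup>2 * a * b"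
  shows "(\<Sum>x\<in>#eigenvalues_mset (\<sigma> \<cdot>\<^sub>m deg_matrix V adj + \<rho> \<cdot>\<^sub>m adj_matrix V adj).
      cmod (x - complex_of_real \<Delta>))
    = 2 * real r * \<bar>\<sigma> * (a + b) - \<Delta>\<bar> + real s * \<bar>2 * \<sigma> * a - \<Delta>\<bar>
      + \<bar>\<sigma> * (a + b) - \<rho> * a - \<Delta>\<bar> + \<bar>e - \<Delta>\<bar> + \<bar>f - \<Delta>\<bar>"
  unfolding eigenvalues_combination[OF assms]
  by (simp del: of_real_add of_real_mult of_nat_Suc of_real_diff add: image_mset.compositionality o_def sum_mset_sum_list sum_list_replicate
      flip: of_real_diff)

section \<open>Closed forms for the three energies\<close>

lemma energy_eq: "energy V adj = a + sqrt (a\<^sup>2 + 8 * a * b)"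
proof -
  let ?D = "sqrt (a\<^sup>2 + 8 * a * b)"
  have D: "?D * ?D = a\<^sup>2 + 8 * a * b" "a \<le> ?D"
    by (auto intro!: real_le_rsqrt)
  have "adj_matrix V adj = 0 \<cdot>\<^sub>m deg_matrix V adj + 1 \<cdot>\<^sub>m adj_matrix V adj"
    by (rule eq_matI) (auto simp: deg_matrix_def adj_matrix_def)
  hence "energy V adj = (\<Sum>x\<in>#eigenvalues_mset (0 \<cdot>\<^sub>m deg_matrix V adj + 1 \<cdot>\<^sub>m adj_matrix V adj).
      cmod (x - complex_of_real 0))"
    by (simp add: energy_def)
  \<comment> \<open>Here \<open>e + f = a\<close> and \<open>e * f = - 2 * a * b\<close>. The
    leading \<open>a\<close> is the modulus of the eigenvalue \<open>- a\<close>, and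
    \<open>a \<le> ?D\<close> makes the last term nonpositive before its modulus is taken.\<close>
  also have "\<dots> = a + \<bar>(a + ?D) / 2\<bar> + \<bar>(a - ?D) / 2\<bar>"
    by (subst sum_eigenvalues_combination[of "(a + ?D) / 2" "(a - ?D) / 2"])
      (use D in \<open>auto simp: field_simps power2_eq_square simp del: of_nat_Suc\<close>)
  also have "\<dots> = a + ?D" using D(2) by (simp add: field_simps del: of_nat_Suc)
  finally show ?thesis .
qed

text \<open>The quadratic factor has the roots \<open>2 * a + b\<close> and 0. The former coincides
  with the eigenvalue of the linear factor, hence the coefficient 2.\<close>

lemma L_energy_eq:
  defines "\<Delta> \<equiv> avg_degree V adj"
  shows "L_energy V adj = 2 * real r * \<bar>a + b - \<Delta>\<bar> + real s * \<bar>2 * a - \<Delta>\<bar>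
    + 2 * \<bar>2 * a + b - \<Delta>\<bar> + \<bar>\<Delta>\<bar>"
proof -
  have "laplacian_matrix V adj = 1 \<cdot>\<^sub>m deg_matrix V adj + (- 1) \<cdot>\<^sub>m adj_matrix V adj"
    by (rule eq_matI) (auto simp: laplacian_matrix_def deg_matrix_def adj_matrix_def)
  hence "L_energy V adj = 2 * real r * \<bar>1 * (a + b) - \<Delta>\<bar> + real s * \<bar>2 * 1 * a - \<Delta>\<bar>
      + \<bar>1 * (a + b) - (- 1) * a - \<Delta>\<bar> + \<bar>(2 * a + b) - \<Delta>\<bar> + \<bar>0 - \<Delta>\<bar>"
    unfolding L_energy_def \<Delta>_def
    by (simp only:) (rule sum_eigenvalues_combination, simp_all)
  thus ?thesis by (simp add: algebra_simps)
qed

text \<open>The roots stay parameters, so that the octahedron can use integers and the general bound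
  can use square roots.\<close>

lemma Q_energy_eq:
  fixes e f :: real
  defines "\<Delta> \<equiv> avg_degree V adj"
  assumes "e + f = 4 * a + b" "e * f = 4 * a\<^sup>2"
  shows "Q_energy V adj = 2 * real r * \<bar>a + b - \<Delta>\<bar> + real s * \<bar>2 * a - \<Delta>\<bar>
    + \<bar>b - \<Delta>\<bar> + \<bar>e - \<Delta>\<bar> + \<bar>f - \<Delta>\<bar>"
proof -
  have "signless_laplacian_matrix V adj = 1 \<cdot>\<^sub>m deg_matrix V adj + 1 \<cdot>\<^sub>m adj_matrix V adj"
    by (rule eq_matI) (auto simp: signless_laplacian_matrix_def deg_matrix_def adj_matrix_def)
  hence "Q_energy V adj = 2 * real r * \<bar>1 * (a + b) - \<Delta>\<bar> + real s * \<bar>2 * 1 * a - \<Delta>\<bar>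
      + \<bar>1 * (a + b) - 1 * a - \<Delta>\<bar> + \<bar>e - \<Delta>\<bar> + \<bar>f - \<Delta>\<bar>"
    unfolding Q_energy_def \<Delta>_def
    by (simp only:) (rule sum_eigenvalues_combination, use assms in \<open>simp_all add: algebra_simps power2_eq_square\<close>)
  thus ?thesis by simp
qed

section \<open>Comparison with the energy of the complete graph\<close>

lemma not_hyperenergetic: "\<not> hyperenergetic V adj"
proof -
  \<comment> \<open>The claim amounts to bounding the square root by
    \<open>3 * a + 2 * b - 2\<close>. The difference of the squares is four times the sum of these
    products, which are nonnegative because \<open>a\<close> and \<open>b\<close> are at least
    1.\<close>
  have "0 \<le> (2 * a - 1) * (a - 1)" "0 \<le> b * (a - 2 + b)"
    by (intro mult_nonneg_nonneg; simp)+
  hence "0 \<le> (2 * a - 1) * (a - 1) + b * (a - 2 + b)" by (rule add_nonneg_nonneg)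
  hence "0 \<le> 4 * ((2 * a - 1) * (a - 1) + b * (a - 2 + b))" by (simp only: zero_le_mult_iff) simp
  also have "\<dots> = (3 * a + 2 * b - 2)\<^sup>2 - (a\<^sup>2 + 8 * a * b)"
    by (simp add: algebra_simps power2_eq_square)
  finally have "sqrt (a\<^sup>2 + 8 * a * b) \<le> 3 * a + 2 * b - 2"
    by (intro real_le_lsqrt) auto
  thus ?thesis
    by (simp add: hyperenergetic_def complete_graph_energy_def energy_eq card_V)
qed

text \<open>By the triangle inequality the last two terms sum to at least \<open>e - f\<close>, the
  square root of the discriminant \<open>b\<^sup>2 + 8 * a * b\<close>. Any simpler lower bound
  \<open>c\<close> for that root may replace it.\<close>

lemma Q_energy_ge:
  assumes "c\<^sup>2 \<le> b\<^sup>2 + 8 * a * b" and "\<Delta> = avg_degree V adj"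
  shows "Q_energy V adj \<ge> 2 * real r * \<bar>a + b - \<Delta>\<bar> + real s * \<bar>2 * a - \<Delta>\<bar> + \<bar>b - \<Delta>\<bar> + c"
proof -
  let ?D = "sqrt (b\<^sup>2 + 8 * a * b)"
  let ?e = "(4 * a + b + ?D) / 2" and ?f = "(4 * a + b - ?D) / 2"
  have "?e * ?f = ((4 * a + b)\<^sup>2 - ?D\<^sup>2) / 4"
    by (simp add: algebra_simps power2_eq_square)
  also have "\<dots> = 4 * a\<^sup>2"
    by (simp add: algebra_simps power2_eq_square)
  finally have "Q_energy V adj = 2 * real r * \<bar>a + b - \<Delta>\<bar> + real s * \<bar>2 * a - \<Delta>\<bar>
      + \<bar>b - \<Delta>\<bar> + \<bar>?e - \<Delta>\<bar> + \<bar>?f - \<Delta>\<bar>"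
    unfolding assms(2) by (intro Q_energy_eq) (auto simp: field_simps)
  moreover have "?D = ?e - ?f" by (simp add: field_simps)
  hence "?D \<le> \<bar>?e - \<Delta>\<bar> + \<bar>?f - \<Delta>\<bar>" by linarith
  moreover have "c \<le> ?D" using assms(1) by (rule real_le_rsqrt)
  ultimately show ?thesis by linarith
qed

text \<open>The graph K_{1,1,s+1}, arising from odd \<open>m \<ge> 3\<close>, where 2(N-1) is
  \<open>2 * (t + 2)\<close>.\<close>

lemma hyperenergetic_singletons:
  assumes "r = 0" "s \<ge> 4"
  shows "L_hyperenergetic V adj" "Q_hyperenergetic V adj"
proof -
  define \<Delta> where "\<Delta> = avg_degree V adj"
  define t where "t = real s"
  have t: "t \<ge> 4" using assms(2) by (simp add: t_def)
  have \<Delta>: "\<Delta> = (4 * t + 6) / (t + 3)"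
    unfolding \<Delta>_def avg_degree_eq using assms(1) by (simp add: t_def add_ac)
  \<comment> \<open>The average degree increases with \<open>t\<close>: 22/7 is its value at
    \<open>t = 4\<close>, and 4 is its limit.\<close>
  have bounds: "22 / 7 \<le> \<Delta>" "\<Delta> < 4" using t by (auto simp: \<Delta> field_simps)
  \<comment> \<open>Exceeding 2 here is equivalent to \<open>t * (\<Delta> - 2) > \<Delta>\<close>,
    which is what both energies require.\<close>
  have prod: "(t - 1) * (\<Delta> - 2) \<ge> 3 * (8 / 7)"
    using t bounds by (intro mult_mono) auto
  hence prod': "t * (\<Delta> - 2) > \<Delta>" by (simp add: algebra_simps)
  have "L_energy V adj = t * (\<Delta> - 2) + 2 * (t + 3 - \<Delta>) + \<Delta>"
    using L_energy_eq assms(1) t bounds by (simp add: \<Delta>_def[symmetric] t_def)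
  also have "\<dots> > 2 * (t + 2)"
    using prod' bounds by (simp add: algebra_simps)
  finally show "L_hyperenergetic V adj"
    using assms(1) by (simp add: L_hyperenergetic_def complete_graph_energy_def card_V t_def)
  \<comment> \<open>The square of \<open>t + 3\<close> is t^2 + 6t + 9, below the discriminant t^2 +
    10t + 9.\<close>
  have "Q_energy V adj \<ge> t * (\<Delta> - 2) + (t + 1 - \<Delta>) + (t + 3)"
    using Q_energy_ge[of "t + 3" \<Delta>] assms(1) t bounds
    by (simp add: \<Delta>_def[symmetric] t_def power2_eq_square algebra_simps)
  moreover have "t * (\<Delta> - 2) + (t + 1 - \<Delta>) + (t + 3) > 2 * (t + 2)"
    using prod' by (simp add: algebra_simps)
  ultimately have "Q_energy V adj > 2 * (t + 2)" by linarith
  thus "Q_hyperenergetic V adj"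
    using assms(1) by (simp add: Q_hyperenergetic_def complete_graph_energy_def card_V t_def)
qed

text \<open>The graph K_{2,2,s+1}, arising from even \<open>m \<ge> 4\<close>, where 2(N-1) is
  \<open>2 * (t + 4)\<close>.\<close>

lemma hyperenergetic_pairs:
  assumes "r = 1" "s \<ge> 5"
  shows "L_hyperenergetic V adj" "Q_hyperenergetic V adj"
proof -
  define \<Delta> where "\<Delta> = avg_degree V adj"
  define t where "t = real s"
  have t: "t \<ge> 5" using assms(2) by (simp add: t_def)
  have \<Delta>: "\<Delta> = (8 * t + 16) / (t + 5)"
    unfolding \<Delta>_def avg_degree_eq using assms(1) by (simp add: t_def add_ac)
  have bounds: "28 / 5 \<le> \<Delta>" "\<Delta> < 8" using t by (auto simp: \<Delta> field_simps)
  \<comment> \<open>Gives \<open>\<Delta> \<le> b\<close>, which fixes the signs inside the absolute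
    values with \<open>b\<close> and \<open>a + b\<close>.\<close>
  have "0 \<le> (t - 5) * (t + 3)" using t by (intro mult_nonneg_nonneg) auto
  hence "\<Delta> \<le> t + 1" using t by (simp add: \<Delta> field_simps)
  note bounds = bounds this
  have prod: "t * (\<Delta> - 4) \<ge> 5 * (\<Delta> - 4)"
    using t bounds by (intro mult_right_mono) auto
  have "L_energy V adj = 2 * (t + 3 - \<Delta>) + t * (\<Delta> - 4) + 2 * (t + 5 - \<Delta>) + \<Delta>"
    using L_energy_eq assms(1) t bounds by (simp add: \<Delta>_def[symmetric] t_def)
  also have "\<dots> > 2 * (t + 4)"
    using prod bounds t by (simp add: algebra_simps)
  finally show "L_hyperenergetic V adj"
    using assms(1) by (simp add: L_hyperenergetic_def complete_graph_energy_def card_V t_def)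
  have "Q_energy V adj \<ge> 2 * (t + 3 - \<Delta>) + t * (\<Delta> - 4) + (t + 1 - \<Delta>) + (t + 5)"
    using Q_energy_ge[of "t + 5" \<Delta>] assms(1) t bounds
    by (simp add: \<Delta>_def[symmetric] t_def power2_eq_square algebra_simps)
  moreover have "2 * (t + 3 - \<Delta>) + t * (\<Delta> - 4) + (t + 1 - \<Delta>) + (t + 5) > 2 * (t + 4)"
    using prod bounds t by (simp add: algebra_simps)
  ultimately have "Q_energy V adj > 2 * (t + 4)" by linarith
  thus "Q_hyperenergetic V adj"
    using assms(1) by (simp add: Q_hyperenergetic_def complete_graph_energy_def card_V t_def)
qed

lemma not_hyperenergetic_octahedron:
  assumes "r = 1" "s = 1"
  shows "\<not> L_hyperenergetic V adj" "\<not> Q_hyperenergetic V adj"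
proof -
  have \<Delta>: "avg_degree V adj = 4" unfolding avg_degree_eq using assms by simp
  show "\<not> L_hyperenergetic V adj"
    using L_energy_eq assms
    by (simp add: L_hyperenergetic_def complete_graph_energy_def card_V \<Delta>)
  show "\<not> Q_hyperenergetic V adj"
    \<comment> \<open>For \<open>a = b = 2\<close> the sum is 10 and the product 16, so the roots
      are 8 and 2.\<close>
    using Q_energy_eq[of 8 2] assms
    by (simp add: Q_hyperenergetic_def complete_graph_energy_def card_V \<Delta>)
qed

end

section \<open>Conjugacy classes\<close>

lemma (in group) conj_class_iff:
  assumes "a \<in> carrier G" "c \<in> carrier G"
  shows "c \<in> conj_class G a \<longleftrightarrow> (\<exists>g\<in>carrier G. g \<otimes> a = c \<otimes> g)"
proof
  assume "c \<in> conj_class G a"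
  then obtain g where "g \<in> carrier G" "c = g \<otimes> a \<otimes> inv g" by (auto simp: conj_class_def)
  moreover from this have "g \<otimes> a = c \<otimes> g" using assms by (simp add: m_assoc)
  ultimately show "\<exists>g\<in>carrier G. g \<otimes> a = c \<otimes> g" by blast
next
  assume "\<exists>g\<in>carrier G. g \<otimes> a = c \<otimes> g"
  then obtain g where g: "g \<in> carrier G" "g \<otimes> a = c \<otimes> g" by blast
  hence "c = g \<otimes> a \<otimes> inv g" using assms by (metis inv_solve_right m_closed)
  thus "c \<in> conj_class G a" using g(1) unfolding conj_class_def by blast
qed

lemma (in group) conj_class_subset: "a \<in> carrier G \<Longrightarrow> conj_class G a \<subseteq> carrier G"
  by (auto simp: conj_class_def)

lemma (in group) conj_int_pow:
  assumes "g \<in> carrier G" "a \<in> carrier G"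
  shows "(g \<otimes> a \<otimes> inv g) [^] (i::int) = g \<otimes> a [^] i \<otimes> inv g"
proof -
  interpret group_hom G G "\<lambda>a. g \<otimes> a \<otimes> inv g"
    by unfold_locales (use assms in \<open>auto simp: hom_def m_assoc inv_solve_left\<close>)
  show ?thesis using hom_int_pow[OF assms(2), of i] by simp
qed

section \<open>Normal form for the elements of V_{8m}\<close>

locale V8m = group G for G (structure) +
  fixes m :: nat and x y :: 'a
  assumes V8m: "is_V8m G m x y" and m_ge_2: "m \<ge> 2"
begin

lemma
  shows x [simp]: "x \<in> carrier G" and y [simp]: "y \<in> carrier G"
    and gen: "generate G {x, y} = carrier G"
    and x_pow: "x [^] (2 * m) = \<one>" and y_pow: "y [^] (4::nat) = \<one>"
    and yx: "y \<otimes> x = inv x \<otimes> inv y" and iyx: "inv y \<otimes> x = inv x \<otimes> y"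
    and fin: "finite (carrier G)" and card_G: "card (carrier G) = 8 * m"
  using V8m by (auto simp: is_V8m_def)

definition w :: "int \<Rightarrow> int \<Rightarrow> 'a" where "w i j = x [^] i \<otimes> y [^] j"

lemma w_closed [simp]: "w i j \<in> carrier G" by (simp add: w_def)

text \<open>The second relation gives x^-1 = y^-1 x y^-1. Inserted into y(yx) = y x^-1 y^-1, it
  yields x y^-2, and y^-2 = y^2.\<close>

lemma y_sq_comm: "(y [^] (2::int)) \<otimes> x = x \<otimes> y [^] (2::int)"
proof -
  have y2: "y [^] (2::int) = y \<otimes> y"
    using int_pow_mult[of y 1 1] by simp
  have "y \<otimes> (y \<otimes> x) = y \<otimes> inv x \<otimes> inv y" by (simp add: yx m_assoc)
  also have "inv x = inv y \<otimes> x \<otimes> inv y" by (simp add: iyx m_assoc)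
  finally have "y \<otimes> (y \<otimes> x) = x \<otimes> inv y \<otimes> inv y" by (simp add: m_assoc flip: m_assoc[of y "inv y"])
  also have "\<dots> = x \<otimes> (y \<otimes> y)"
  proof -
    have "y [^] (4::nat) = (y \<otimes> y) \<otimes> (y \<otimes> y)"
      by (simp add: numeral_eq_Suc m_assoc)
    hence "inv (y \<otimes> y) = y \<otimes> y" using y_pow by (intro inv_equality) auto
    thus ?thesis by (simp add: inv_mult_group m_assoc)
  qed
  finally show ?thesis unfolding y2 by (simp add: m_assoc)
qed

lemma comm_int_pow:
  assumes "g \<in> carrier G" "h \<in> carrier G" "g \<otimes> h = h \<otimes> g"
  shows "g [^] (i::int) \<otimes> h = h \<otimes> g [^] i"
proof -
  have "h \<otimes> g [^] i \<otimes> inv h = (h \<otimes> g \<otimes> inv h) [^] i"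
    using conj_int_pow[of h g i] assms by simp
  also have "h \<otimes> g \<otimes> inv h = g" using assms by (metis inv_solve_right m_closed)
  finally show ?thesis using assms by (metis int_pow_closed inv_solve_right m_closed)
qed

lemma y_even_comm:
  assumes "even j" shows "y [^] j \<otimes> x [^] i = x [^] (i::int) \<otimes> y [^] (j::int)"
proof -
  obtain k where j: "j = 2 * k" using assms by (elim evenE)
  have "(y [^] (2::int)) [^] k \<otimes> x = x \<otimes> (y [^] (2::int)) [^] k"
    by (rule comm_int_pow) (use y_sq_comm in auto)
  hence "y [^] j \<otimes> x = x \<otimes> y [^] j" by (simp add: int_pow_pow j)
  from comm_int_pow[OF _ _ this[symmetric], of i] show ?thesis by simp
qed

text \<open>Conjugation by \<open>y\<close> sends x to x^-1 y^-2, whose two factors commute, so its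
  powers can be taken factor by factor.\<close>

lemma y_x_pow: "y \<otimes> x [^] i = x [^] (- i) \<otimes> y [^] (1 - 2 * i :: int)"
proof -
  have "y \<otimes> x [^] i \<otimes> inv y = (y \<otimes> x \<otimes> inv y) [^] i"
    by (simp add: conj_int_pow)
  also have "y \<otimes> x \<otimes> inv y = x [^] (-1::int) \<otimes> y [^] (-2::int)"
    using int_pow_mult[of y "-1" "-1"] by (simp add: yx m_assoc int_pow_neg)
  also have "\<dots> [^] i = x [^] (- i) \<otimes> y [^] (- 2 * i)"
    by (subst int_pow_mult_distrib) (auto simp: y_even_comm int_pow_pow)
  finally have "y \<otimes> x [^] i = x [^] (- i) \<otimes> y [^] (- 2 * i) \<otimes> y"
    by (metis int_pow_closed inv_solve_right m_closed x y)
  also have "\<dots> = x [^] (- i) \<otimes> y [^] (- 2 * i + 1)"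
    by (simp only: m_assoc int_pow_closed x y int_pow_mult int_pow_1)
  finally show ?thesis by (simp add: algebra_simps)
qed

lemma w_cong:
  assumes "2 * int m dvd i - i'" "4 dvd j - j'"
  shows "w i j = w i' j'"
proof -
  obtain k l where kl: "i = i' + 2 * int m * k" "j = j' + 4 * l"
    using assms by (auto simp: dvd_def algebra_simps)
  have "x [^] (2 * int m) = \<one>" "y [^] (4::int) = \<one>"
    using x_pow y_pow int_pow_int[of G x "2 * m"] int_pow_int[of G y 4] by auto
  hence "x [^] (2 * int m * k) = \<one>" "y [^] (4 * l) = \<one>"
    by (simp_all flip: int_pow_pow)
  thus ?thesis by (simp add: w_def kl int_pow_mult)
qed

text \<open>An even power of \<open>y\<close> commutes with \<open>x\<close>; an odd power inverts
  x^k and contributes y^(2k). This rule turns all later group computations into congruences.\<close>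

lemma w_mult: "w i j \<otimes> w k l = (if even j then w (i + k) (j + l) else w (i - k) (j + 2 * k + l))"
proof (cases "even j")
  case True
  have "w i j \<otimes> w k l = x [^] i \<otimes> (y [^] j \<otimes> x [^] k) \<otimes> y [^] l"
    by (simp add: w_def m_assoc)
  also have "\<dots> = w (i + k) (j + l)"
    using True by (simp add: y_even_comm w_def m_assoc int_pow_mult)
  finally show ?thesis using True by simp
next
  case False
  have "w i j \<otimes> w k l = x [^] i \<otimes> (y [^] (j - 1 + 1) \<otimes> x [^] k) \<otimes> y [^] l"
    by (simp add: w_def m_assoc)
  also have "\<dots> = x [^] i \<otimes> (y [^] (j - 1) \<otimes> (y \<otimes> x [^] k)) \<otimes> y [^] l"
    unfolding int_pow_mult[OF y] by (simp add: m_assoc)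
  also have "\<dots> = x [^] i \<otimes> ((y [^] (j - 1) \<otimes> x [^] (- k)) \<otimes> y [^] (1 - 2 * k)) \<otimes> y [^] l"
    unfolding y_x_pow by (simp add: m_assoc)
  also have "\<dots> = x [^] i \<otimes> ((x [^] (- k) \<otimes> y [^] (j - 1)) \<otimes> y [^] (1 - 2 * k)) \<otimes> y [^] l"
    using False by (subst y_even_comm) auto
  also have "\<dots> = w (i + - k) (j - 1 + (1 - 2 * k) + l)"
    by (simp only: w_def m_assoc int_pow_mult int_pow_closed m_closed x y)
  \<comment> \<open>The exponents of \<open>y\<close> differ by a multiple of 4, so y^(-2k) may be
    written y^(2k).\<close>
  also have "\<dots> = w (i - k) (j + 2 * k + l)"
    by (rule w_cong) auto
  finally show ?thesis using False by simp
qed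

lemma carrier_w:
  assumes "g \<in> carrier G" obtains i j where "g = w i j"
proof -
  have "g \<in> generate G {x, y}" using assms gen by simp
  hence "\<exists>i j. g = w i j"
  proof induction
    case one
    have "\<one> = w 0 0" by (simp add: w_def)
    thus ?case by blast
  next
    case (incl h)
    have "x = w 1 0" "y = w 0 1" by (simp_all add: w_def)
    thus ?case using incl by blast
  next
    case (inv h)
    have "inv x = w (-1) 0" "inv y = w 0 (-1)" by (simp_all add: w_def int_pow_neg)
    thus ?case using inv by blast
  next
    case (eng g h)
    thus ?case by (metis w_mult)
  qed
  thus ?thesis using that by blast
qed

text \<open>Counting: the 8m reduced exponent pairs map onto a group of order 8m, so the map is
  injective.\<close>

lemma w_eq_iff: "w i j = w k l \<longleftrightarrow> 2 * int m dvd i - k \<and> 4 dvd j - l"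
proof
  let ?R = "{0..<2 * int m} \<times> {0..<4::int}"
  have red: "w i j = w (i mod (2 * int m)) (j mod 4)" for i j
    by (rule w_cong) (simp_all add: minus_mod_eq_div_mult[symmetric])
  have red_mem: "(i mod (2 * int m), j mod 4) \<in> ?R" for i j using m_ge_2 by auto
  have "(\<lambda>(i, j). w i j) ` ?R = carrier G"
  proof (intro equalityI subsetI)
    fix g assume "g \<in> carrier G"
    then obtain i j where "g = w i j" by (rule carrier_w)
    thus "g \<in> (\<lambda>(i, j). w i j) ` ?R" using red red_mem by force
  qed auto
  hence "inj_on (\<lambda>(i, j). w i j) ?R"
    by (intro eq_card_imp_inj_on) (simp_all add: card_G nat_mult_distrib)
  moreover assume "w i j = w k l"
  hence "w (i mod (2 * int m)) (j mod 4) = w (k mod (2 * int m)) (l mod 4)"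
    using red by metis
  ultimately have "(i mod (2 * int m), j mod 4) = (k mod (2 * int m), l mod 4)"
    using red_mem[of i j] red_mem[of k l] by (intro inj_onD[of "\<lambda>(i, j). w i j" ?R]) simp_all
  hence "i mod (2 * int m) = k mod (2 * int m) \<and> j mod 4 = l mod 4" by simp
  thus "2 * int m dvd i - k \<and> 4 dvd j - l" by (simp add: mod_eq_dvd_iff)
qed (auto intro: w_cong)

section \<open>Conjugacy classes, centre and commuting elements\<close>

lemma w_eq_parity:
  assumes "w i j = w k l" shows "(even i \<longleftrightarrow> even k) \<and> (even j \<longleftrightarrow> even l)"
proof -
  have "2 dvd 2 * int m" "(2::int) dvd 4" by simp_all
  hence "even (i - k)" "even (j - l)"
    using assms unfolding w_eq_iff by (blast intro: dvd_trans)+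
  thus ?thesis by simp
qed

text \<open>For even \<open>j\<close>, conjugating by \<open>w k l\<close> depends only on the
  parity of \<open>l\<close>. For odd \<open>j\<close>, it shifts both exponents by the same even
  amount, and every even shift occurs.\<close>

lemma conj_class_w:
  "conj_class G (w i j) = (if even j then {w i j, w (- i) (j + 2 * i)} else {w (i + 2 * k) (j + 2 * k) | k. True})"
proof (rule Set.set_eqI)
  fix c
  show "c \<in> conj_class G (w i j) \<longleftrightarrow>
    c \<in> (if even j then {w i j, w (- i) (j + 2 * i)} else {w (i + 2 * k) (j + 2 * k) | k. True})"
  proof (cases "c \<in> carrier G")
    case False
    thus ?thesis using conj_class_subset[of "w i j"] w_closed by (auto split: if_splits)
  next
    case True
    then obtain i' j' where c: "c = w i' j'" by (rule carrier_w)
    have "c \<in> conj_class G (w i j) \<longleftrightarrow> (\<exists>k l. w k l \<otimes> w i j = w i' j' \<otimes> w k l)"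
      unfolding c by (subst conj_class_iff) (auto elim: carrier_w, metis carrier_w)
    also have "\<dots> \<longleftrightarrow> c \<in> (if even j then {w i j, w (- i) (j + 2 * i)} else {w (i + 2 * k) (j + 2 * k) | k. True})"
    proof (cases "even j")
      case True
      have "w k l \<otimes> w i j = w i' j' \<otimes> w k l \<longleftrightarrow>
          w i' j' = (if even l then w i j else w (- i) (j + 2 * i))" (is "?lhs \<longleftrightarrow> ?rhs") for k l
      proof -
        have *: "k + i - (i' + k) = - (i' - i)" "k - i - (i' + k) = - (i' - - i)"
          by simp_all
        have dvd: "2 * int m dvd k + i - (i' + k) \<longleftrightarrow> 2 * int m dvd i' - i"
          "2 * int m dvd k - i - (i' + k) \<longleftrightarrow> 2 * int m dvd i' - - i"
          unfolding * dvd_minus_iff by auto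
        have dvd4: "4 dvd l + j - (j' + l) \<longleftrightarrow> 4 dvd j' - j"
          "4 dvd l + 2 * i + j - (j' + l) \<longleftrightarrow> 4 dvd j' - (j + 2 * i)"
          by presburger+
        \<comment> \<open>The parity of \<open>j'\<close> must be known first, as the product
          formula branches on it.\<close>
        have "even j'" if "?lhs \<or> ?rhs"
          using that True by (auto simp: w_mult dest!: w_eq_parity split: if_splits)
        moreover have "?lhs \<longleftrightarrow> ?rhs" if "even j'"
          using that True dvd dvd4 by (simp add: w_mult w_eq_iff)
        ultimately show ?thesis by blast
      qed
      hence "(\<exists>k l. w k l \<otimes> w i j = w i' j' \<otimes> w k l) \<longleftrightarrow>
          (\<exists>l::int. w i' j' = (if even l then w i j else w (- i) (j + 2 * i)))" by simp
      also have "\<dots> \<longleftrightarrow> w i' j' = w i j \<or> w i' j' = w (- i) (j + 2 * i)"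
        by (metis even_zero odd_one)
      finally show ?thesis using True c by simp
    next
      case False
      \<comment> \<open>The half-shift is \<open>k\<close> for even \<open>l\<close> and
        \<open>k - i\<close> for odd \<open>l\<close>; letting \<open>k\<close> vary, even
        \<open>l\<close> alone reaches all shifts.\<close>
      have "w k l \<otimes> w i j = w i' j' \<otimes> w k l \<longleftrightarrow>
          w i' j' = (if even l then w (i + 2 * k) (j + 2 * k) else w (i + 2 * (k - i)) (j + 2 * (k - i)))"
        (is "?lhs \<longleftrightarrow> ?rhs") for k l
      proof -
        have *: "k + i - (i' - k) = - (i' - (i + 2 * k))" "k - i - (i' - k) = - (i' - (i + 2 * (k - i)))"
          by simp_all
        have dvd: "2 * int m dvd k + i - (i' - k) \<longleftrightarrow> 2 * int m dvd i' - (i + 2 * k)"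
          "2 * int m dvd k - i - (i' - k) \<longleftrightarrow> 2 * int m dvd i' - (i + 2 * (k - i))"
          unfolding * dvd_minus_iff by auto
        have dvd4: "4 dvd l + j - (j' + 2 * k + l) \<longleftrightarrow> 4 dvd j' - (j + 2 * k)"
          "4 dvd l + 2 * i + j - (j' + 2 * k + l) \<longleftrightarrow> 4 dvd j' - (j + 2 * (k - i))"
          by presburger+
        have "odd j'" if "?lhs \<or> ?rhs"
          using that False by (auto simp: w_mult dest!: w_eq_parity split: if_splits)
        moreover have "?lhs \<longleftrightarrow> ?rhs" if "odd j'"
          using that False dvd dvd4 by (simp add: w_mult w_eq_iff)
        ultimately show ?thesis by blast
      qed
      hence "(\<exists>k l. w k l \<otimes> w i j = w i' j' \<otimes> w k l) \<longleftrightarrow>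
          (\<exists>k l. w i' j' = (if even (l::int) then w (i + 2 * k) (j + 2 * k)
            else w (i + 2 * (k - i)) (j + 2 * (k - i))))" by simp
      also have "\<dots> \<longleftrightarrow> (\<exists>k. w i' j' = w (i + 2 * k) (j + 2 * k))"
        by (metis even_zero)
      finally show ?thesis using False c by simp
    qed
    finally show ?thesis .
  qed
qed

text \<open>Commuting with \<open>x\<close> excludes odd \<open>j\<close>, since it would force
  \<open>2 * int m\<close> to divide 2. Commuting with \<open>y\<close> then gives the conditions on
  \<open>i\<close>.\<close>

lemma w_mem_center: "w i j \<in> grp_center G \<longleftrightarrow> even j \<and> even i \<and> int m dvd i"
proof
  assume *: "w i j \<in> grp_center G"
  hence comm: "w i j \<otimes> w k l = w k l \<otimes> w i j" for k l by (auto simp: grp_center_def)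
  have "even j"
  proof (rule ccontr)
    assume "odd j"
    with comm[of 1 0] have "2 * int m dvd i - 1 - (1 + i)" by (simp add: w_mult w_eq_iff)
    hence "2 * int m dvd 2" by simp
    hence "2 * int m \<le> 2" by (rule zdvd_imp_le) simp
    thus False using m_ge_2 by simp
  qed
  moreover from this have "2 * int m dvd i + i" "4 dvd - (2 * i)"
    using comm[of 0 1] by (auto simp: w_mult w_eq_iff)
  hence "int m dvd i" and "4 dvd 2 * i" by simp_all
  moreover from this(2) have "even i" by presburger
  ultimately show "even j \<and> even i \<and> int m dvd i" by simp
next
  assume *: "even j \<and> even i \<and> int m dvd i"
  hence "2 * int m dvd i + i" by (simp flip: mult_2)
  hence "2 * int m dvd i + k - (k - i)" "2 * int m dvd i + k - (k + i)" for k by simp_all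
  moreover have "4 dvd j + l - (l + 2 * i + j)" for l
  proof -
    have "even i" using * by simp
    thus ?thesis by presburger
  qed
  ultimately show "w i j \<in> grp_center G"
    using * by (auto simp: grp_center_def w_mult w_eq_iff elim!: carrier_w)
qed

text \<open>An element with even \<open>y\<close>-exponent that commutes with one of odd
  \<open>y\<close>-exponent satisfies the centre conditions. If both exponents are odd, comparison
  modulo 4 equates the parities of \<open>i\<close> and \<open>k\<close>.\<close>

lemma w_comm_imp_same_part:
  assumes "w i j \<otimes> w k l = w k l \<otimes> w i j" "w i j \<notin> grp_center G" "w k l \<notin> grp_center G"
  shows "even j \<and> even l \<or> odd j \<and> odd l \<and> (even i \<longleftrightarrow> even k)"
proof -
  have False if "even j" "odd l" "w i j \<otimes> w k l = w k l \<otimes> w i j" "w i j \<notin> grp_center G" for i j k l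
  proof -
    have "2 * int m dvd i + k - (k - i)" "4 dvd j + l - (l + 2 * i + j)"
      using that by (auto simp: w_mult w_eq_iff)
    hence "2 * int m dvd 2 * i" by simp
    moreover have "even i" using \<open>4 dvd _\<close> by presburger
    ultimately show False using that by (simp add: w_mem_center)
  qed
  moreover have "even i \<longleftrightarrow> even k" if "odd j" "odd l"
  proof -
    have "4 dvd j + 2 * k + l - (l + 2 * i + j)"
      using that assms(1) by (simp add: w_mult w_eq_iff)
    thus ?thesis by presburger
  qed
  ultimately show ?thesis using assms by metis
qed

section \<open>The three parts and adjacency\<close>

lemma conj_class_self: "w i j \<in> conj_class G (w i j)"
  unfolding conj_class_w by (auto intro: exI[of _ 0])

text \<open>Parities of exponents are constant on a conjugacy class, so any representative decides
  its label.\<close>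

definition part :: "'a set \<Rightarrow> nat" where
  "part C = (if \<exists>i j. w i j \<in> C \<and> odd j \<and> even i then 0
     else if \<exists>i j. w i j \<in> C \<and> odd j \<and> odd i then 1 else 2)"

lemma conj_class_parity:
  assumes "w i' j' \<in> conj_class G (w i j)"
  shows "(even j' \<longleftrightarrow> even j) \<and> (even i' \<longleftrightarrow> even i)"
  using assms unfolding conj_class_w by (auto split: if_splits dest!: w_eq_parity)

lemma part_conj_class: "part (conj_class G (w i j)) = (if even j then 2 else if even i then 0 else 1)"
proof -
  have "(\<exists>k l. w k l \<in> conj_class G (w i j) \<and> odd l \<and> even k) \<longleftrightarrow> odd j \<and> even i"
    "(\<exists>k l. w k l \<in> conj_class G (w i j) \<and> odd l \<and> odd k) \<longleftrightarrow> odd j \<and> odd i"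
    using conj_class_parity conj_class_self by blast+
  thus ?thesis by (simp add: part_def)
qed

lemma conj_class_not_central:
  assumes "w i j \<notin> grp_center G" "w i' j' \<in> conj_class G (w i j)"
  shows "w i' j' \<notin> grp_center G"
proof
  assume c: "w i' j' \<in> grp_center G"
  obtain g where g: "g \<in> carrier G" "g \<otimes> w i j = w i' j' \<otimes> g"
    using assms(2) by (auto simp: conj_class_iff)
  moreover have "w i' j' \<otimes> g = g \<otimes> w i' j'" using c g by (simp add: grp_center_def)
  ultimately have "w i j = w i' j'" by simp
  thus False using c assms(1) by simp
qed

lemma vertexE:
  assumes "C \<in> nccc_vertices G"
  obtains i j where "C = conj_class G (w i j)" "w i j \<notin> grp_center G"
  using assms unfolding nccc_vertices_def by (auto elim!: carrier_w)

lemma conj_class_odd_shift: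
  assumes "odd j"
  shows "conj_class G (w (i + 2 * k) (j + 2 * k)) = conj_class G (w i j)"
proof -
  have "(\<exists>t. c = w (i + 2 * k + 2 * t) (j + 2 * k + 2 * t)) \<longleftrightarrow> (\<exists>t. c = w (i + 2 * t) (j + 2 * t))" for c
  proof
    assume "\<exists>t. c = w (i + 2 * k + 2 * t) (j + 2 * k + 2 * t)"
    then obtain t where "c = w (i + 2 * k + 2 * t) (j + 2 * k + 2 * t)" ..
    thus "\<exists>t. c = w (i + 2 * t) (j + 2 * t)"
      by (intro exI[of _ "k + t"]) (simp add: algebra_simps)
  next
    assume "\<exists>t. c = w (i + 2 * t) (j + 2 * t)"
    then obtain t where "c = w (i + 2 * t) (j + 2 * t)" ..
    thus "\<exists>t. c = w (i + 2 * k + 2 * t) (j + 2 * k + 2 * t)"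
      by (intro exI[of _ "t - k"]) simp
  qed
  thus ?thesis using assms unfolding conj_class_w by simp
qed

lemma adj_iff_part:
  assumes "C \<in> nccc_vertices G" "D \<in> nccc_vertices G"
  shows "nccc_adj G C D \<longleftrightarrow> part C \<noteq> part D"
proof -
  obtain i j where C: "C = conj_class G (w i j)" "w i j \<notin> grp_center G" using assms(1) by (rule vertexE)
  obtain k l where D: "D = conj_class G (w k l)" "w k l \<notin> grp_center G" using assms(2) by (rule vertexE)
  show ?thesis
  proof
    assume adj: "nccc_adj G C D"
    have nc: "w i j \<otimes> w k' l' \<noteq> w k' l' \<otimes> w i j" if "w k' l' \<in> D" for k' l'
      using adj that conj_class_self unfolding nccc_adj_def C by blast
    show "part C \<noteq> part D"
    proof
      assume "part C = part D"
      hence "even j \<and> even l \<or> odd j \<and> odd l \<and> (even i \<longleftrightarrow> even k)"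
        unfolding C D part_conj_class by (auto split: if_splits)
      thus False
      proof (elim disjE conjE)
        assume "even j" "even l"
        thus False using nc[of k l] conj_class_self unfolding D by (simp add: w_mult add.commute)
      next
        assume *: "odd j" "odd l" "even i \<longleftrightarrow> even k"
        hence "even (i - k)" by simp
        then obtain t where "i - k = 2 * t" by (elim evenE)
        hence t: "i = k + 2 * t" by simp
        \<comment> \<open>A shifted representative with the same \<open>x\<close>-exponent as
          \<open>w i j\<close>; for odd \<open>y\<close>-exponents, equal \<open>x\<close>-exponents
          make the two commute.\<close>
        have "w i (l + 2 * t) \<in> D" unfolding D(1) t using *(2) by (auto simp: conj_class_w)
        from nc[OF this] show False using * by (simp add: w_mult algebra_simps)
      qed
    qed
  next
    assume neq: "part C \<noteq> part D"
    have "a \<otimes> b \<noteq> b \<otimes> a" if ab: "a \<in> C" "b \<in> D" for a b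
    proof
      assume comm: "a \<otimes> b = b \<otimes> a"
      have "a \<in> carrier G" "b \<in> carrier G"
        using ab conj_class_subset[OF w_closed] unfolding C D by auto
      then obtain i' j' k' l' where ab': "a = w i' j'" "b = w k' l'" by (elim carrier_w)
      have "even j' \<and> even l' \<or> odd j' \<and> odd l' \<and> (even i' \<longleftrightarrow> even k')"
        using comm ab conj_class_not_central C D unfolding ab' by (intro w_comm_imp_same_part) auto
      moreover have "(even j' \<longleftrightarrow> even j) \<and> (even i' \<longleftrightarrow> even i)" "(even l' \<longleftrightarrow> even l) \<and> (even k' \<longleftrightarrow> even k)"
        using ab unfolding C D ab' by (auto dest: conj_class_parity)
      ultimately show False using neq unfolding C D part_conj_class by (auto split: if_splits)
    qed
    thus "nccc_adj G C D" using neq by (auto simp: nccc_adj_def)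
  qed
qed

section \<open>Counting the classes in each part\<close>

lemma card_odd_part:
  assumes c: "c \<in> {0, 1}"
  shows "card {C \<in> nccc_vertices G. part C = c} = (if odd m then 1 else 2)"
proof -
  let ?K = "\<lambda>j. conj_class G (w (int c) j)"
  \<comment> \<open>An even shift brings the \<open>x\<close>-exponent to \<open>c\<close>, after
    which the odd \<open>y\<close>-exponent is 1 or 3 modulo 4.\<close>
  have "{C \<in> nccc_vertices G. part C = c} = {?K 1, ?K 3}"
  proof (intro equalityI subsetI)
    fix C assume "C \<in> {C \<in> nccc_vertices G. part C = c}"
    then obtain i j where C: "C = conj_class G (w i j)" "part C = c" by (auto elim!: vertexE)
    hence ij: "odd j" "even i \<longleftrightarrow> c = 0" using c by (auto simp: part_conj_class split: if_splits)
    hence "even (int c - i)" using c by auto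
    then obtain k where "int c - i = 2 * k" by (elim evenE)
    hence k: "int c = i + 2 * k" by simp
    have "C = ?K (j + 2 * k)" using conj_class_odd_shift[OF ij(1), of i k] C k by simp
    moreover have "odd (j + 2 * k)" using ij by simp
    hence "4 dvd j + 2 * k - 1 \<or> 4 dvd j + 2 * k - 3" by presburger
    hence "w (int c) (j + 2 * k) = w (int c) 1 \<or> w (int c) (j + 2 * k) = w (int c) 3"
      by (simp add: w_eq_iff)
    ultimately show "C \<in> {?K 1, ?K 3}" by auto
  next
    fix C assume "C \<in> {?K 1, ?K 3}"
    thus "C \<in> {C \<in> nccc_vertices G. part C = c}"
      using c by (auto simp: nccc_vertices_def part_conj_class w_mem_center)
  qed
  \<comment> \<open>Identifying them takes a shift by \<open>2 * k\<close> with
    \<open>int m dvd k\<close>, to restore the \<open>x\<close>-exponent, and \<open>k\<close> odd,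
    to move 1 to 3.\<close>
  moreover have "?K 1 = ?K 3 \<longleftrightarrow> odd m"
  proof
    assume "?K 1 = ?K 3"
    hence "w (int c) 3 \<in> ?K 1" using conj_class_self by simp
    then obtain k where k: "w (int c) 3 = w (int c + 2 * k) (1 + 2 * k)"
      unfolding conj_class_w by auto
    hence "2 * int m dvd 2 * k" "4 dvd 2 - 2 * k" by (auto simp: w_eq_iff)
    hence "int m dvd k" by simp
    moreover have "odd k" using \<open>4 dvd _\<close> by presburger
    ultimately show "odd m" by (metis dvd_trans even_of_nat)
  next
    assume "odd m"
    have "w (int c + 2 * int m) (1 + 2 * int m) = w (int c) 3"
      unfolding w_eq_iff using \<open>odd m\<close> by (simp) presburger
    thus "?K 1 = ?K 3" using conj_class_odd_shift[of 1 "int c" "int m"] by simp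
  qed
  ultimately show ?thesis by auto
qed

lemma conj_class_even_reflect:
  assumes "even j"
  shows "conj_class G (w (- i) (j + 2 * i)) = conj_class G (w i j)"
  using assms unfolding conj_class_w by (simp add: insert_commute)

lemma card_even_part: 
  "card {C \<in> nccc_vertices G. part C = 2} = (if odd m then 2 * m - 1 else 2 * m - 2)"
proof -
  let ?K = "\<lambda>(i, j). conj_class G (w i j)"
  \<comment> \<open>Representatives modulo the reflection of \<open>i\<close> to \<open>- i\<close>.
    The value \<open>i = 0\<close> is central, as is \<open>i = m\<close> for even \<open>m\<close>;
    for odd \<open>m\<close> the two candidates at \<open>i = m\<close> are conjugate, so only one
    is kept.\<close>
  define R where "R = {1..<int m} \<times> {0, 2 :: int} \<union> (if odd m then {(int m, 0)} else {})"
  have R: "1 \<le> i" "i \<le> int m" "j = 0 \<or> j = 2" "i = int m \<Longrightarrow> j = 0 \<and> odd m" if "(i, j) \<in> R" for i j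
    using that m_ge_2 by (auto simp: R_def split: if_splits)
  have "{C \<in> nccc_vertices G. part C = 2} = ?K ` R"
  proof (intro equalityI subsetI)
    fix C assume "C \<in> {C \<in> nccc_vertices G. part C = 2}"
    then obtain i j where C: "C = conj_class G (w i j)" "w i j \<notin> grp_center G" "part C = 2"
      by (auto elim!: vertexE)
    have j: "even j" using C by (auto simp: part_conj_class split: if_splits)
    have "\<exists>i' j'. C = conj_class G (w i' j') \<and> even j' \<and> 0 \<le> i' \<and> i' \<le> int m"
    proof (cases "i mod (2 * int m) \<le> int m")
      case True
      have "w i j = w (i mod (2 * int m)) j"
        unfolding w_eq_iff by (simp add: minus_mod_eq_div_mult[symmetric])
      thus ?thesis using C(1) j True m_ge_2 by (intro exI[of _ "i mod (2 * int m)"] exI[of _ j]) simp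
    next
      case False
      have "- i - (2 * int m - i mod (2 * int m)) = - (i - i mod (2 * int m)) - 2 * int m" by simp
      also have "2 * int m dvd \<dots>"
        by (intro dvd_diff) (simp_all only: dvd_minus_iff dvd_refl dvd_minus_mod)
      finally have "w (- i) (j + 2 * i) = w (2 * int m - i mod (2 * int m)) (j + 2 * i)"
        unfolding w_eq_iff by simp
      moreover have "i mod (2 * int m) \<le> 2 * int m" using m_ge_2 by (simp add: less_imp_le)
      ultimately show ?thesis using C(1) j False conj_class_even_reflect[OF j, of i]
        by (intro exI[of _ "2 * int m - i mod (2 * int m)"] exI[of _ "j + 2 * i"]) simp
    qed
    then obtain i' j' where ij': "C = conj_class G (w i' j')" "even j'" "0 \<le> i'" "i' \<le> int m" by blast
    define l where "l = j' mod 4"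
    have l: "l = 0 \<or> l = 2" using ij'(2) unfolding l_def by presburger
    have "w i' j' = w i' l" unfolding l_def w_eq_iff by (simp add: dvd_minus_mod)
    hence Cl: "C = conj_class G (w i' l)" using ij'(1) by simp
    have nc: "w i' l \<notin> grp_center G"
      using conj_class_not_central[OF C(2)] conj_class_self[of i' l] Cl C(1) by simp
    hence "i' \<noteq> 0" using l by (auto simp: w_mem_center)
    show "C \<in> ?K ` R"
    proof (cases "i' = int m")
      case False
      thus ?thesis using Cl l ij'(3,4) \<open>i' \<noteq> 0\<close> by (auto simp: R_def)
    next
      case True
      hence m: "odd m" using nc l by (auto simp: w_mem_center)
      have "w (- int m) (2 + 2 * int m) = w (int m) 0"
        unfolding w_eq_iff using m by (simp) presburger
      hence "conj_class G (w (int m) 2) = conj_class G (w (int m) 0)"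
        using conj_class_even_reflect[of 2 "int m"] by simp
      hence "C = ?K (int m, 0)" using Cl True l by auto
      thus ?thesis using m by (auto simp: R_def)
    qed
  next
    fix C assume "C \<in> ?K ` R"
    then obtain i j where ij: "(i, j) \<in> R" "C = conj_class G (w i j)" by auto
    note Rij = R[OF ij(1)]
    have "\<not> (even i \<and> int m dvd i)"
    proof
      assume *: "even i \<and> int m dvd i"
      hence "int m \<le> i" using Rij(1) by (intro zdvd_imp_le) auto
      thus False using Rij * by auto
    qed
    thus "C \<in> {C \<in> nccc_vertices G. part C = 2}"
      using Rij ij by (auto simp: nccc_vertices_def part_conj_class w_mem_center)
  qed
  moreover have "inj_on ?K R"
  proof (rule inj_onI, clarify)
    fix i j k l assume ij: "(i, j) \<in> R" and kl: "(k, l) \<in> R"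
      and eq: "conj_class G (w i j) = conj_class G (w k l)"
    note Rij = R[OF ij] and Rkl = R[OF kl]
    have "w i j \<in> conj_class G (w k l)" using eq conj_class_self by metis
    hence "w i j = w k l \<or> w i j = w (- k) (l + 2 * k)"
      using Rkl(3) by (auto simp: conj_class_w)
    thus "i = k \<and> j = l"
    proof
      assume "w i j = w k l"
      hence *: "2 * int m dvd i - k" "4 dvd j - l" by (auto simp: w_eq_iff)
      have "\<bar>i - k\<bar> < 2 * int m" using Rij(1,2) Rkl(1,2) by linarith
      hence "i = k" using *(1) dvd_imp_le_int[of "i - k" "2 * int m"] by fastforce
      moreover have "j = l" using *(2) Rij(3) Rkl(3) by auto
      ultimately show ?thesis by simp
    next
      assume "w i j = w (- k) (l + 2 * k)"
      hence *: "2 * int m dvd i + k" by (auto simp: w_eq_iff)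
      \<comment> \<open>Since \<open>i\<close> and \<open>k\<close> are at most \<open>m\<close>, a
        reflection can only match them at \<open>i = k = m\<close>, where \<open>R\<close> contains
        a single pair.\<close>
      hence "2 * int m \<le> i + k" using Rij(1) Rkl(1) by (intro zdvd_imp_le) auto
      hence "i = int m" "k = int m" using Rij(2) Rkl(2) by auto
      thus ?thesis using Rij(4) Rkl(4) by simp
    qed
  qed
  moreover have "card R = (if odd m then 2 * m - 1 else 2 * m - 2)"
  proof -
    have "card ({1..<int m} \<times> {0, 2 :: int}) = 2 * m - 2"
      using m_ge_2 by (simp add: card_cartesian_product nat_diff_distrib)
    thus ?thesis unfolding R_def using m_ge_2 by (auto simp: card_insert_disjoint)
  qed
  ultimately show ?thesis by (simp add: card_image)
qed

lemma finite_vertices: "finite (nccc_vertices G)"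
  using fin by (simp add: nccc_vertices_def)

text \<open>The parameters are one less than the part sizes: 1, 1, 2m-1 for odd \<open>m\<close> and
  2, 2, 2m-2 for even \<open>m\<close>.\<close>

lemma complete_tripartite:
  "complete_tripartite (nccc_vertices G) (nccc_adj G) part (if odd m then 0 else 1)
     (if odd m then 2 * m - 2 else 2 * m - 3)"
proof
  fix C assume "C \<in> nccc_vertices G"
  show "part C < 3" by (simp add: part_def)
qed (use card_odd_part[of 0] card_odd_part[of 1] card_even_part m_ge_2 in
    \<open>auto simp: finite_vertices adj_iff_part\<close>)

end

section \<open>Energies\<close>

theorem theorem4p5:
  fixes G :: "('a, 'b) monoid_scheme" and m :: nat and x y :: 'a
  assumes "m \<ge> 2" and "is_V8m G m x y"
  shows "\<not> hyperenergetic (nccc_vertices G) (nccc_adj G)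
    \<and> (L_hyperenergetic (nccc_vertices G) (nccc_adj G) \<longleftrightarrow> m \<noteq> 2)
    \<and> (Q_hyperenergetic (nccc_vertices G) (nccc_adj G) \<longleftrightarrow> m \<noteq> 2)"
proof -
  interpret group G using assms(2) by (simp add: is_V8m_def)
  interpret V8m G m x y by unfold_locales (use assms in auto)
  interpret complete_tripartite "nccc_vertices G" "nccc_adj G" part "if odd m then 0 else 1"
    "if odd m then 2 * m - 2 else 2 * m - 3"
    by (rule complete_tripartite)
  \<comment> \<open>These give the octahedron (\<open>r = s = 1\<close>), singletons with
    \<open>s = 2 * m - 2 \<ge> 4\<close>, and pairs with
    \<open>s = 2 * m - 3 \<ge> 5\<close>.\<close>
  consider "m = 2" | "odd m" "m \<ge> 3" | "even m" "m \<ge> 4"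
    using assms(1) by (cases "m = 2"; cases "m = 3") auto
  thus ?thesis
  proof cases
    case 1
    thus ?thesis using not_hyperenergetic not_hyperenergetic_octahedron by simp
  next
    case 2
    thus ?thesis using not_hyperenergetic hyperenergetic_singletons by simp
  next
    case 3
    thus ?thesis using not_hyperenergetic hyperenergetic_pairs by simp
  qed
qed

end
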